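(* Let $(j_n)_{n\ge 0}$ be defined by $j_0=0$, $j_{2k}=j_k$ and $j_{2k+1}=(-1)^k$ for all $k\ge 0$, and let $s_n=1+\sum_{0\le k\le n} j_k$. Let $(b_n)_{n\ge 0}$ be the increasing sequence of positive integers whose odd part is of the form $4k+3$. Then $b_n-s_{b_n}=2n+1$ for all $n\ge 0$.
   Context: The odd part of a positive integer $m$ is the odd integer $m/2^{v}$ where $2^v$ is the largest power of $2$ dividing $m$. *)

theory Defs
  imports "HOL-Computational_Algebra.Primes" "HOL-Library.Infinite_Set"
begin

text \<open>The case \<open>n = 0\<close> is separated only for termination; the recurrences are
  \<open>j_seq_0\<close>, \<open>j_seq_even\<close> and \<open>j_seq_odd\<close> below.\<close>

fun j_seq :: "nat \<Rightarrow> int" where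
  "j_seq n = (if n = 0 then 0
              else if even n then j_seq (n div 2)
              else (- 1) ^ (n div 2))"

declare j_seq.simps [simp del]

lemma j_seq_0: "j_seq 0 = 0"
  by (simp add: j_seq.simps)

lemma j_seq_even: "j_seq (2 * k) = j_seq k"
  by (cases "k = 0") (simp_all add: j_seq.simps [of "2 * k"])

lemma j_seq_odd: "j_seq (2 * k + 1) = (- 1) ^ k"
  by (subst j_seq.simps) simp

definition s_seq :: "nat \<Rightarrow> int" where
  "s_seq n = 1 + (\<Sum>k = 0..n. j_seq k)"

definition odd_part :: "nat \<Rightarrow> nat" where
  "odd_part m = m div 2 ^ multiplicity 2 m"

definition B_set :: "nat set" where
  "B_set = {m. m > 0 \<and> (\<exists>k. odd_part m = 4 * k + 3)}"

text \<open>\<^term>\<open>enumerate\<close> lists a set in increasing order, starting at index \<open>0\<close>;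
  it exhausts \<open>B_set\<close> without repetition because that set is infinite.\<close>

definition b_seq :: "nat \<Rightarrow> nat" where
  "b_seq = enumerate B_set"

lemma infinite_B_set: "infinite B_set"
proof -
  have "4 * k + 3 \<in> B_set" for k :: nat
  proof -
    have "\<not> 2 dvd 4 * k + 3" by presburger
    then show ?thesis
      by (simp add: B_set_def odd_part_def not_dvd_imp_multiplicity_0)
  qed
  then have "range (\<lambda>k::nat. 4 * k + 3) \<subseteq> B_set" by blast
  moreover have "infinite (range (\<lambda>k::nat. 4 * k + 3))"
    by (rule range_inj_infinite) (simp add: inj_on_def)
  ultimately show ?thesis by (rule infinite_super)
qed

lemma strict_mono_b_seq: "strict_mono b_seq"
  unfolding b_seq_def using infinite_B_set by (rule strict_mono_enumerate)

lemma range_b_seq: "range b_seq = B_set"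
  unfolding b_seq_def using infinite_B_set by (rule range_enumerate)

end

theory Submission
  imports Defs
begin

text \<open>For \<open>m > 0\<close> the value \<open>j_seq m\<close> is \<open>-1\<close> or \<open>1\<close> according to whether the odd part of
  \<open>m\<close> is \<open>3\<close> or \<open>1\<close> modulo \<open>4\<close>. Hence \<open>m - s_seq m + 1\<close> is twice the number of elements
  of \<open>B_set\<close> up to \<open>m\<close>, and that number is \<open>n + 1\<close> for \<open>m = b_seq n\<close>.\<close>

lemma odd_part_odd: "odd m \<Longrightarrow> odd_part m = m"
  by (simp add: odd_part_def not_dvd_imp_multiplicity_0)

lemma odd_part_double: "k > 0 \<Longrightarrow> odd_part (2 * k) = odd_part k"
  by (simp add: odd_part_def multiplicity_times_same)

lemma odd_in_B_set_iff: "2 * k + 1 \<in> B_set \<longleftrightarrow> odd k"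
proof -
  have "2 * k + 1 \<in> B_set \<longleftrightarrow> (\<exists>l. 2 * k + 1 = 4 * l + 3)"
    by (simp add: B_set_def odd_part_odd)
  also have "\<dots> \<longleftrightarrow> odd k" by presburger
  finally show ?thesis .
qed

lemma double_in_B_set_iff: "2 * k \<in> B_set \<longleftrightarrow> k \<in> B_set"
  by (cases "k = 0") (simp_all add: B_set_def odd_part_double)

text \<open>Both sides obey the same recursion: doubling changes neither, and at
  \<open>2 * k + 1\<close> the parity of \<open>k\<close> decides both.\<close>

lemma j_seq_eq:
  assumes "m > 0"
  shows "j_seq m = (if m \<in> B_set then - 1 else 1)"
  using assms
proof (induction m rule: less_induct)
  case (less m)
  show ?case
  proof (cases "even m")
    case True
    then obtain k where "m = 2 * k" by blast
    with less show ?thesis by (simp add: j_seq_even double_in_B_set_iff)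
  next
    case False
    then obtain k where m: "m = 2 * k + 1" by (blast elim: oddE)
    show ?thesis unfolding m j_seq_odd odd_in_B_set_iff by simp
  qed
qed

text \<open>Each index from 1 to \<open>m\<close> adds 1, or 1 - 2 if it lies in
  \<open>B_set\<close>; index 0 adds nothing.\<close>

lemma s_seq_eq: "s_seq m = 1 + int m - 2 * int (card (B_set \<inter> {..m}))"
proof (induction m)
  case 0
  have "B_set \<inter> {..0} = {}" by (auto simp: B_set_def)
  then show ?case by (simp add: s_seq_def j_seq_0)
next
  case (Suc m)
  have "s_seq (Suc m) = s_seq m + j_seq (Suc m)"
    by (simp add: s_seq_def)
  with Suc.IH show ?case
    by (simp add: j_seq_eq atMost_Suc)
qed

lemma card_B_set_upto_b_seq: "card (B_set \<inter> {..b_seq n}) = Suc n"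
proof -
  \<comment> \<open>\<open>b_seq\<close> is increasing with range \<open>B_set\<close>, so
    \<open>b_seq i\<close> is at most \<open>b_seq n\<close> exactly when \<open>i \<le> n\<close>;
    indices start at 0, hence \<open>Suc n\<close> elements.\<close>
  have "B_set \<inter> {..b_seq n} = b_seq ` {..n}"
    by (auto simp: range_b_seq [symmetric] strict_mono_less_eq [OF strict_mono_b_seq])
  moreover have "inj_on b_seq {..n}"
    using strict_mono_b_seq by (rule strict_mono_imp_inj_on)
  ultimately show ?thesis by (simp add: card_image)
qed

theorem theorem7:
  fixes n :: nat
  shows "int (b_seq n) - s_seq (b_seq n) = 2 * int n + 1"
  by (simp add: s_seq_eq card_B_set_upto_b_seq)

end
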